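(* Let $k\ge 1$ and $\delta\ge 2$. If $G$ is a connected graph on $$n\ge(\delta^2+k\delta+7\delta+6k+9)(\delta^2+k\delta+1)$$ vertices with minimum degree $\delta(G)\ge\delta$ such that $$q(G)\ge 2(n-\delta-k-1),$$ then $G$ is $k$-path-coverable unless $G\in\mathcal{B}_1(n,k,\delta)$.
   Context: Graphs $G$ under consideration are simple and connected; $k,\delta,n$ are integers. For a graph $G$, $\delta(G)$ is its minimum degree, $A(G)$ its adjacency matrix, $D(G)$ the diagonal matrix of vertex degrees, $Q(G)=D(G)+A(G)$ its signless Laplacian matrix, and $q(G)$ (the $Q$-index) the largest eigenvalue of $Q(G)$. A graph $G$ is $k$-path-coverable if its vertex set $V(G)$ can be covered by $k$ or fewer vertex-disjoint paths. $G\cup H$ denotes the disjoint union, and $G\vee H$ the join, obtained from $G\cup H$ by adding all possible edges between $G$ and $H$. $K_m$ is the complete graph and $\overline{K_m}$ the edgeless graph on $m$ vertices. Let $$B(n,k,\delta)=K_\delta\vee\bigl(K_{n-2\delta-k}\cup\overline{K_{\delta+k}}\bigr).$$ With degrees taken in $B(n,k,\delta)$, let $X=\{v: d(v)=\delta\}$, $Y=\{v: d(v)=n-1\}$ and $Z=\{v: d(v)=n-k-\delta-1\}$. Let $E_1$ be the set of edges of $B(n,k,\delta)$ whose endpoints are both in $Y\cup Z$. For $E'\subset E_1$, $B(n,k,\delta)-E'$ is the graph obtained from $B(n,k,\delta)$ by deleting the edges in $E'$. Define $$\mathcal{B}_1(n,k,\delta)=\Bigl\{G\subseteq B(n,k,\delta)-E'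 : E'\subset E_1,\ |E'|\le\Bigl\lfloor\tfrac{(\delta+k)\delta}{4}\Bigr\rfloor\Bigr\},$$ where $G\subseteq B(n,k,\delta)-E'$ means that $G$ is a subgraph of $B(n,k,\delta)-E'$. *)

theory Defs
  imports "Jordan_Normal_Form.Char_Poly"
begin

record 'a graph =
  verts :: "'a set"
  edges :: "'a set set"

definition simple_graph :: "'a graph \<Rightarrow> bool" where
  "simple_graph G \<longleftrightarrow>
     finite (verts G) \<and> edges G \<subseteq> {e. e \<subseteq> verts G \<and> card e = 2}"

definition vdegree :: "'a graph \<Rightarrow> 'a \<Rightarrow> nat" where
  "vdegree G v = card {e \<in> edges G. v \<in> e}"

definition min_degree :: "'a graph \<Rightarrow> nat" where
  "min_degree G = Min (vdegree G ` verts G)"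

(* A path is the list of its vertices; a single vertex is a path. *)
definition is_path :: "'a graph \<Rightarrow> 'a list \<Rightarrow> bool" where
  "is_path G p \<longleftrightarrow>
     p \<noteq> [] \<and> set p \<subseteq> verts G \<and> distinct p \<and> successively (\<lambda>u v. {u, v} \<in> edges G) p"

definition connected_graph :: "'a graph \<Rightarrow> bool" where
  "connected_graph G \<longleftrightarrow> verts G \<noteq> {} \<and>
     (\<forall>u\<in>verts G. \<forall>v\<in>verts G. \<exists>p. is_path G p \<and> hd p = u \<and> last p = v)"

definition path_coverable :: "nat \<Rightarrow> 'a graph \<Rightarrow> bool" where
  "path_coverable k G \<longleftrightarrow>
     (\<exists>P. finite P \<and> card P \<le> k \<and> (\<forall>p\<in>P. is_path G p) \<and>
          pairwise (\<lambda>p q. set p \<inter> set q = {}) P \<and> (\<Union>p\<in>P. set p) = verts G)"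

(* Matrices are indexed by 0, ..., n - 1, so the vertices are numbered by an arbitrary
   enumeration. Another enumeration conjugates the matrices below by a permutation matrix,
   which does not change the eigenvalues. *)
definition vertex_list :: "'a graph \<Rightarrow> 'a list" where
  "vertex_list G = (SOME vs. distinct vs \<and> set vs = verts G)"

definition adjacency_matrix :: "'a graph \<Rightarrow> real mat" where
  "adjacency_matrix G = (let vs = vertex_list G; n = card (verts G) in
     mat n n (\<lambda>(i, j). if {vs ! i, vs ! j} \<in> edges G then 1 else 0))"

definition degree_matrix :: "'a graph \<Rightarrow> real mat" where
  "degree_matrix G = (let vs = vertex_list G; n = card (verts G) in
     mat n n (\<lambda>(i, j). if i = j then real (vdegree G (vs ! i)) else 0))"

definition signless_laplacian :: "'a graph \<Rightarrow> real mat" where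
  "signless_laplacian G = degree_matrix G + adjacency_matrix G"

definition Q_index :: "'a graph \<Rightarrow> real" where
  "Q_index G = Max {x. eigenvalue (signless_laplacian G) x}"

definition complete_graph :: "nat \<Rightarrow> nat graph" where
  "complete_graph m = \<lparr>verts = {..<m}, edges = {e. e \<subseteq> {..<m} \<and> card e = 2}\<rparr>"

definition empty_graph :: "nat \<Rightarrow> nat graph" where
  "empty_graph m = \<lparr>verts = {..<m}, edges = {}\<rparr>"

definition disjoint_union :: "'a graph \<Rightarrow> 'b graph \<Rightarrow> ('a + 'b) graph" where
  "disjoint_union G H = \<lparr>verts = verts G <+> verts H,
     edges = (`) Inl ` edges G \<union> (`) Inr ` edges H\<rparr>"

definition join_graph :: "'a graph \<Rightarrow> 'b graph \<Rightarrow> ('a + 'b) graph" where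
  "join_graph G H = \<lparr>verts = verts G <+> verts H,
     edges = edges (disjoint_union G H) \<union> {{Inl u, Inr v} |u v. u \<in> verts G \<and> v \<in> verts H}\<rparr>"

definition delete_edges :: "'a graph \<Rightarrow> 'a set set \<Rightarrow> 'a graph" where
  "delete_edges G F = \<lparr>verts = verts G, edges = edges G - F\<rparr>"

definition subgraph :: "'a graph \<Rightarrow> 'a graph \<Rightarrow> bool" where
  "subgraph H G \<longleftrightarrow> simple_graph H \<and> verts H \<subseteq> verts G \<and> edges H \<subseteq> edges G"

definition graph_iso :: "'a graph \<Rightarrow> 'b graph \<Rightarrow> bool" where
  "graph_iso G H \<longleftrightarrow>
     (\<exists>f. bij_betw f (verts G) (verts H) \<and> edges H = (`) f ` edges G)"

(* The natural-number subtraction is not truncated when n \<ge> 2 * d + k, the range in which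
   the graph B(n,k,d) is meaningful. *)
definition B_graph :: "nat \<Rightarrow> nat \<Rightarrow> nat \<Rightarrow> (nat + (nat + nat)) graph" where
  "B_graph n k d =
     join_graph (complete_graph d)
       (disjoint_union (complete_graph (n - 2 * d - k)) (empty_graph (d + k)))"

definition Y_set :: "nat \<Rightarrow> nat \<Rightarrow> nat \<Rightarrow> (nat + (nat + nat)) set" where
  "Y_set n k d = {v \<in> verts (B_graph n k d). vdegree (B_graph n k d) v = n - 1}"

definition Z_set :: "nat \<Rightarrow> nat \<Rightarrow> nat \<Rightarrow> (nat + (nat + nat)) set" where
  "Z_set n k d = {v \<in> verts (B_graph n k d). vdegree (B_graph n k d) v = n - k - d - 1}"

definition E1_set :: "nat \<Rightarrow> nat \<Rightarrow> nat \<Rightarrow> (nat + (nat + nat)) set set" where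
  "E1_set n k d = {e \<in> edges (B_graph n k d). e \<subseteq> Y_set n k d \<union> Z_set n k d}"

(* Graphs are identified up to isomorphism: G belongs to the family if an isomorphic copy of G
   is a subgraph of B(n,k,d) - E'. On nat, div is the floor of the quotient. *)
definition B1_family :: "nat \<Rightarrow> nat \<Rightarrow> nat \<Rightarrow> 'a graph set" where
  "B1_family n k d =
     {G. \<exists>E' H. E' \<subseteq> E1_set n k d \<and> card E' \<le> ((d + k) * d) div 4 \<and>
            subgraph H (delete_edges (B_graph n k d) E') \<and> graph_iso G H}"

end

theory Submission
  imports Defs "Jordan_Normal_Form.Spectral_Radius"
begin

text \<open>
The family \<open>B1_family n k \<delta>\<close> contains every graph that embeds in \<open>B(n, k, \<delta>)\<close>, because \<open>E' = {}\<close> is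
one of the admissible sets of deleted edges. So it is enough to embed in \<open>B(n, k, \<delta>)\<close> each graph
\<open>G\<close> that satisfies the hypotheses and is not \<open>k\<close>-path-coverable.

The spectral hypothesis is used only to show that few edges are missing. Merris' bound
(\<open>signless_laplacian_eigenvalue_bound\<close>) gives a vertex whose degree and average neighbour degree add
up to at least \<open>2 * (n - \<delta> - k - 1)\<close>; the degrees of this vertex and its neighbours alone then show
that \<open>G\<close> lacks at most \<open>(\<delta> + k) * n\<close> edges (\<open>degree_sum_lower_bound\<close>).

The rest is a closure argument in the manner of Bondy and Chvatal. Adding an edge between
nonadjacent vertices of degree sum at least \<open>n - k\<close> does not create \<open>k\<close>-path-coverability
(\<open>orderable_remove_edge\<close>), so \<open>G\<close> lies in a graph \<open>H\<close> on the same vertices that is still not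
coverable and in which nonadjacent vertices have degree sum below \<open>n - k\<close> (\<open>path_closure\<close>).
As few edges are missing and \<open>n\<close> is large, \<open>H\<close> consists of a clique and at most \<open>\<delta> + k\<close> vertices \<open>S\<close>
of degree at most \<open>|S| - k\<close> (\<open>closed_graph_low_degree_vertices\<close>). The minimum degree forces
\<open>|S| = \<delta> + k\<close> and degree exactly \<open>\<delta>\<close> on \<open>S\<close>, and the closure condition forces every clique vertex
with a neighbour in \<open>S\<close> to be joined to all of \<open>S\<close>. If there are \<open>\<delta>\<close> such vertices, then \<open>S\<close> is
independent and \<open>H\<close> is \<open>B(n, k, \<delta>)\<close>. If there is none, \<open>H\<close> is disconnected, and so is \<open>G\<close>. If their number lies
strictly between, the regular graph induced on \<open>S\<close> has enough edges for an economical path cover,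
and \<open>H\<close> would be coverable (\<open>dense_nonorderable_structure\<close>).

Graphs enter the closure argument as symmetric irreflexive relations on a finite vertex set, and
path covers as orderings of the vertices with few nonadjacent consecutive pairs.
\<close>

section \<open>Orderings with few breaks\<close>

fun breaks :: "('a \<Rightarrow> 'a \<Rightarrow> bool) \<Rightarrow> 'a list \<Rightarrow> nat" where
  "breaks R [] = 0"
| "breaks R [x] = 0"
| "breaks R (x # y # zs) = (if R x y then 0 else 1) + breaks R (y # zs)"

text \<open>This is coverability by \<open>b + 1\<close> vertex-disjoint paths: cutting an ordering at its breaks gives the
paths. A single list is easier to rotate, reverse and cut than a set of paths.\<close>

definition orderable :: "'a set \<Rightarrow> ('a \<Rightarrow> 'a \<Rightarrow> bool) \<Rightarrow> nat \<Rightarrow> bool" where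
  "orderable V R b \<longleftrightarrow> (\<exists>ws. distinct ws \<and> set ws = V \<and> breaks R ws \<le> b)"

definition degree_in :: "'a set \<Rightarrow> ('a \<Rightarrow> 'a \<Rightarrow> bool) \<Rightarrow> 'a \<Rightarrow> nat" where
  "degree_in V R v = card {w \<in> V. R v w}"

lemma breaks_append:
  "breaks R (xs @ ys) = breaks R xs + breaks R ys +
     (if xs \<noteq> [] \<and> ys \<noteq> [] \<and> \<not> R (last xs) (hd ys) then 1 else 0)"
proof (induction R xs rule: breaks.induct)
  case (2 R x)
  then show ?case by (cases ys) auto
qed auto

lemma breaks_rev:
  assumes "symp R"
  shows "breaks R (rev xs) = breaks R xs"
proof (induction xs)
  case (Cons x xs)
  have "breaks R (rev (x # xs)) = breaks R xs + (if xs \<noteq> [] \<and> \<not> R (hd xs) x then 1 else 0)"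
    using Cons.IH by (simp add: breaks_append last_rev)
  also have "\<dots> = breaks R (x # xs)"
    using assms by (cases xs) (auto dest: sympD)
  finally show ?case .
qed simp

lemma breaks_cong:
  assumes "\<And>xs x y ys. ws = xs @ x # y # ys \<Longrightarrow> R x y = R' x y"
  shows "breaks R ws = breaks R' ws"
  using assms
proof (induction R ws rule: breaks.induct)
  case (3 R x y zs)
  have "R x y = R' x y" using "3.prems"[of "[]"] by simp
  moreover have "breaks R (y # zs) = breaks R' (y # zs)"
  proof (rule "3.IH")
    fix as a b bs assume "y # zs = as @ a # b # bs"
    then show "R a b = R' a b" using "3.prems"[of "x # as" a b bs] by simp
  qed
  ultimately show ?case by simp
qed auto

lemma breaks_split:
  assumes "breaks R ws > 0"
  obtains xs x y ys where "ws = xs @ x # y # ys" "\<not> R x y"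
proof -
  have "\<exists>xs x y ys. ws = xs @ x # y # ys \<and> \<not> R x y"
    using assms
  proof (induction R ws rule: breaks.induct)
    case (3 R x y zs)
    show ?case
    proof (cases "R x y")
      case True
      with 3 obtain as a b bs where "y # zs = as @ a # b # bs" "\<not> R a b" by auto
      then show ?thesis by (intro exI[of _ "x # as"] exI[of _ a] exI[of _ b] exI[of _ bs]) simp
    next
      case False
      then show ?thesis by (intro exI[of _ "[]"] exI[of _ x] exI[of _ y] exI[of _ zs]) simp
    qed
  qed auto
  then show thesis using that by blast
qed

lemma breaks_eq_card:
  "breaks R ws = card {i. Suc i < length ws \<and> \<not> R (ws ! i) (ws ! Suc i)}"
proof (induction R ws rule: breaks.induct)
  case (3 R x y zs)
  let ?A = "{i. Suc i < length (y # zs) \<and> \<not> R ((y # zs) ! i) ((y # zs) ! Suc i)}"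
  have "{i. Suc i < length (x # y # zs) \<and> \<not> R ((x # y # zs) ! i) ((x # y # zs) ! Suc i)}
      = (if R x y then {} else {0}) \<union> Suc ` ?A"
    (is "?B = _")
  proof (rule Set.set_eqI)
    fix i show "i \<in> ?B \<longleftrightarrow> i \<in> (if R x y then {} else {0}) \<union> Suc ` ?A"
      by (cases i) auto
  qed
  moreover have "finite ?A" by (rule finite_subset[of _ "{..<length (y # zs)}"]) auto
  moreover have "card (Suc ` ?A) = card ?A" by (simp add: card_image)
  ultimately show ?case using 3 by auto
qed auto

lemma breaks_complete:
  assumes "distinct ws" "\<And>x y. x \<in> set ws \<Longrightarrow> y \<in> set ws \<Longrightarrow> x \<noteq> y \<Longrightarrow> R x y"
  shows "breaks R ws = 0"
  using assms by (induction R ws rule: breaks.induct) auto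

text \<open>Closing an ordering to a cycle and cutting the cycle at one of its breaks loses that break. Hence
a cyclic arrangement may have one break more than the ordering extracted from it.\<close>

lemma breaks_le_rotation:
  assumes "zs \<noteq> []" and "breaks R zs + (if R (last zs) (hd zs) then 0 else 1) \<le> Suc b"
  obtains ws where "distinct ws = distinct zs" "set ws = set zs" "breaks R ws \<le> b"
proof (cases "R (last zs) (hd zs) \<and> breaks R zs > 0")
  case False
  then have "breaks R zs \<le> b" using assms by auto
  then show ?thesis using that by blast
next
  case True
  then obtain xs x y ys where zs: "zs = xs @ x # y # ys" and nR: "\<not> R x y"
    using breaks_split by blast
  have eq: "zs = (xs @ [x]) @ (y # ys)" using zs by simp
  have "breaks R zs = breaks R (xs @ [x]) + breaks R (y # ys) + 1"
    unfolding eq by (subst breaks_append) (use nR in simp)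
  moreover have "breaks R ((y # ys) @ (xs @ [x])) = breaks R (y # ys) + breaks R (xs @ [x])"
  proof -
    have "last zs = last (y # ys)" "hd zs = hd (xs @ [x])" unfolding zs by (auto simp: hd_append)
    then have "R (last (y # ys)) (hd (xs @ [x]))" using True by simp
    then show ?thesis by (subst breaks_append) simp
  qed
  ultimately have "breaks R ((y # ys) @ (xs @ [x])) \<le> b" using assms True by simp
  then show ?thesis using that[of "(y # ys) @ (xs @ [x])"] unfolding eq by auto
qed

section \<open>Closure under degree sums\<close>

lemma three_sets_overlap:
  assumes "A \<subseteq> U" "B \<subseteq> U" "C \<subseteq> U" "finite U" "card U < card A + card B + card C"
  shows "\<exists>i. i \<in> A \<inter> B \<or> i \<in> A \<inter> C \<or> i \<in> B \<inter> C"
proof (rule ccontr)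
  assume "\<not> ?thesis"
  then have d: "A \<inter> B = {}" "(A \<union> B) \<inter> C = {}" by auto
  have f: "finite A" "finite B" "finite C" using assms finite_subset by blast+
  have "card (A \<union> B \<union> C) = card A + card B + card C"
    using d f by (simp add: card_Un_disjoint)
  moreover have "card (A \<union> B \<union> C) \<le> card U" using assms by (intro card_mono) auto
  ultimately show False using assms by simp
qed

definition add_edge :: "('a \<Rightarrow> 'a \<Rightarrow> bool) \<Rightarrow> 'a \<Rightarrow> 'a \<Rightarrow> 'a \<Rightarrow> 'a \<Rightarrow> bool" where
  "add_edge R u v = (\<lambda>x y. R x y \<or> {x, y} = {u, v})"

text \<open>The exchange argument of Ore, with breaks admitted. For a link of the ordering between positions
\<open>i\<close> and \<open>i + 1\<close>, reversing the part after \<open>i\<close> and closing up to a cycle replaces this link by the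
links from position \<open>i\<close> to the last vertex and from position \<open>i + 1\<close> to the first vertex. Among the
three events ``the first new link is an edge'', ``the second new link is an edge'' and ``the old
link was a break'', two at the same \<open>i\<close> suffice to keep the number of cyclic breaks at the old
number of linear ones, and cutting the cycle at a break then saves one. The events are counted by
the two end degrees and by the number of breaks, and there are only \<open>length w - 1\<close> positions, so
the degree condition forces a coincidence.\<close>

lemma orderable_cycle_exchange:
  assumes R: "symp R" "irreflp R"
    and w: "distinct w" "w \<noteq> []" "breaks R w \<le> Suc b"
    and deg: "length w \<le> degree_in (set w) R (hd w) + degree_in (set w) R (last w) + Suc b"
  shows "orderable (set w) R b"
proof (cases "breaks R w \<le> b")
  case True
  then show ?thesis using w orderable_def by blast
next
  case False
  then have bw: "breaks R w = Suc b" using w by simp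
  let ?n = "length w"
  define A where "A = {i. Suc i < ?n \<and> R (hd w) (w ! Suc i)}"
  define B where "B = {i. Suc i < ?n \<and> R (last w) (w ! i)}"
  define C where "C = {i. Suc i < ?n \<and> \<not> R (w ! i) (w ! Suc i)}"
  have hdw: "hd w = w ! 0" and lastw: "last w = w ! (?n - 1)"
    using w by (auto simp: hd_conv_nth last_conv_nth)
  have irr: "\<not> R x x" for x using R irreflpD by metis
  have "bij_betw (\<lambda>i. w ! Suc i) A {x \<in> set w. R (hd w) x}"
    unfolding bij_betw_def
  proof
    show "inj_on (\<lambda>i. w ! Suc i) A"
      using w by (auto simp: inj_on_def A_def nth_eq_iff_index_eq)
    show "(\<lambda>i. w ! Suc i) ` A = {x \<in> set w. R (hd w) x}"
    proof (intro equalityI subsetI)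
      fix x assume "x \<in> {x \<in> set w. R (hd w) x}"
      then obtain j where j: "j < ?n" "x = w ! j" "R (hd w) x" by (auto simp: in_set_conv_nth)
      then have "j \<noteq> 0" using irr[of "w ! 0"] hdw by (cases j) auto
      then show "x \<in> (\<lambda>i. w ! Suc i) ` A"
        using j by (intro image_eqI[of _ _ "j - 1"]) (auto simp: A_def)
    qed (auto simp: A_def)
  qed
  then have cA: "card A = degree_in (set w) R (hd w)"
    unfolding degree_in_def by (rule bij_betw_same_card)
  have "bij_betw (\<lambda>i. w ! i) B {x \<in> set w. R (last w) x}"
    unfolding bij_betw_def
  proof
    show "inj_on (\<lambda>i. w ! i) B"
      using w by (auto simp: inj_on_def B_def nth_eq_iff_index_eq)
    show "(\<lambda>i. w ! i) ` B = {x \<in> set w. R (last w) x}"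
    proof (intro equalityI subsetI)
      fix x assume "x \<in> {x \<in> set w. R (last w) x}"
      then obtain j where j: "j < ?n" "x = w ! j" "R (last w) x" by (auto simp: in_set_conv_nth)
      then have "j \<noteq> ?n - 1" using irr[of "w ! (?n - 1)"] lastw by (cases "j = ?n - 1") auto
      then show "x \<in> (\<lambda>i. w ! i) ` B"
        using j by (intro image_eqI[of _ _ j]) (auto simp: B_def)
    qed (auto simp: B_def)
  qed
  then have cB: "card B = degree_in (set w) R (last w)"
    unfolding degree_in_def by (rule bij_betw_same_card)
  have cC: "card C = Suc b" using bw unfolding C_def breaks_eq_card .
  \<comment> \<open>Irreflexivity matters in the two counts above: no end vertex is its own neighbour, so each
    neighbour of an end vertex sits at a position that one of the links reaches.\<close>
  have "\<exists>i. i \<in> A \<inter> B \<or> i \<in> A \<inter> C \<or> i \<in> B \<inter> C"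
  proof (rule three_sets_overlap)
    show "A \<subseteq> {..<?n - 1}" "B \<subseteq> {..<?n - 1}" "C \<subseteq> {..<?n - 1}"
      by (auto simp: A_def B_def C_def)
    show "card {..<?n - 1} < card A + card B + card C"
      using deg cA cB cC w by (cases w) auto
  qed simp
  then obtain i where i: "i \<in> A \<inter> B \<or> i \<in> A \<inter> C \<or> i \<in> B \<inter> C" by blast
  then have iw: "Suc i < ?n" by (auto simp: A_def B_def C_def)
  define P where "P = take (Suc i) w"
  define Q where "Q = drop (Suc i) w"
  have ne: "P \<noteq> []" "Q \<noteq> []" using iw by (auto simp: P_def Q_def)
  have PQ: "w = P @ Q" by (simp add: P_def Q_def)
  have ends: "last P = w ! i" "hd Q = w ! Suc i" "hd P = hd w" "last Q = last w"
    using iw w(2) by (simp_all add: P_def Q_def take_Suc_conv_app_nth hd_drop_conv_nth hd_append hd_conv_nth)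
  have "breaks R w = breaks R P + breaks R Q + (if i \<in> C then 1 else 0)"
    using ne ends iw by (subst PQ, subst breaks_append) (simp add: C_def)
  moreover have "breaks R (P @ rev Q) = breaks R P + breaks R Q + (if i \<in> B then 0 else 1)"
    using ne ends iw R by (auto simp: breaks_append breaks_rev B_def hd_rev dest: sympD)
  moreover have "R (last (P @ rev Q)) (hd (P @ rev Q)) \<longleftrightarrow> i \<in> A"
    using ne ends iw R by (auto simp: A_def last_rev dest: sympD)
  ultimately have "breaks R (P @ rev Q) + (if R (last (P @ rev Q)) (hd (P @ rev Q)) then 0 else 1) \<le> Suc b"
    using bw i by auto
  then obtain ws where "distinct ws = distinct (P @ rev Q)" "set ws = set (P @ rev Q)" "breaks R ws \<le> b"
    using breaks_le_rotation[of "P @ rev Q"] ne by blast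
  moreover have "distinct (P @ rev Q) = distinct w" "set (P @ rev Q) = set w"
    by (auto simp: PQ)
  ultimately show ?thesis unfolding orderable_def using w by auto
qed

text \<open>The stability step of the Bondy--Chvatal closure. If the added edge is used by the ordering, the
ordering is rotated so that the two ends of this edge become its first and last vertex; the edge is
then lost, at the price of at most one additional break, and the exchange argument applies.\<close>

lemma orderable_remove_edge:
  assumes R: "symp R" "irreflp R" and uv: "u \<noteq> v"
    and ord: "orderable V (add_edge R u v) b"
    and deg: "card V \<le> degree_in V R u + degree_in V R v + Suc b"
  shows "orderable V R b"
proof -
  obtain ws where ws: "distinct ws" "set ws = V" "breaks (add_edge R u v) ws \<le> b"
    using ord unfolding orderable_def by blast
  consider "\<And>xs x y ys. ws = xs @ x # y # ys \<Longrightarrow> {x, y} \<noteq> {u, v}"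
    | xs x y ys where "ws = xs @ x # y # ys" "{x, y} = {u, v}" by blast
  then show ?thesis
  proof cases
    case 1
    have "breaks R ws = breaks (add_edge R u v) ws"
      by (rule breaks_cong) (use 1 in \<open>auto simp: add_edge_def\<close>)
    then show ?thesis using ws orderable_def by metis
  next
    case (2 xs x y ys)
    have dis: "distinct (xs @ x # y # ys)" using ws 2 by simp
    have p1: "breaks R (xs @ [x]) = breaks (add_edge R u v) (xs @ [x])"
    proof (rule breaks_cong)
      fix as a c cs assume eq: "xs @ [x] = as @ a # c # cs"
      then have "{a, c} \<subseteq> set (xs @ [x])" by auto
      then have "y \<notin> {a, c}" using dis by auto
      then show "R a c = add_edge R u v a c" using 2 by (auto simp: add_edge_def)
    qed
    have p2: "breaks R (y # ys) = breaks (add_edge R u v) (y # ys)"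
    proof (rule breaks_cong)
      fix as a c cs assume eq: "y # ys = as @ a # c # cs"
      then have "{a, c} \<subseteq> set (y # ys)" by auto
      then have "x \<notin> {a, c}" using dis by auto
      then show "R a c = add_edge R u v a c" using 2 by (auto simp: add_edge_def)
    qed
    have "breaks (add_edge R u v) ws \<ge> breaks R (xs @ [x]) + breaks R (y # ys)"
      using breaks_append[of "add_edge R u v" "xs @ [x]" "y # ys"] p1 p2 2 by simp
    then have b: "breaks R ((y # ys) @ xs @ [x]) \<le> Suc b"
      using ws breaks_append[of R "y # ys" "xs @ [x]"] by (simp split: if_splits)
    have setw: "set ((y # ys) @ xs @ [x]) = V" using ws 2 by auto
    have dw: "distinct ((y # ys) @ xs @ [x])" using dis by auto
    have "length ((y # ys) @ xs @ [x]) = card V" using distinct_card[OF dw] setw by simp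
    moreover have "degree_in V R y + degree_in V R x = degree_in V R u + degree_in V R v"
      using 2 uv by (auto simp: doubleton_eq_iff)
    ultimately show ?thesis
      using orderable_cycle_exchange[OF R dw _ b] setw deg by simp
  qed
qed

lemma degree_in_mono:
  assumes "finite V" "\<And>x y. R x y \<Longrightarrow> R' x y"
  shows "degree_in V R v \<le> degree_in V R' v"
  unfolding degree_in_def using assms by (intro card_mono) auto

text \<open>Joining nonadjacent vertices of large degree sum as long as there are any ends in a graph that is
still not orderable and in which every nonadjacent pair has small degree sum.\<close>

lemma path_closure:
  assumes "finite V" "symp R" "irreflp R" "\<not> orderable V R b"
  obtains R' where "symp R'" "irreflp R'" "\<And>x y. R x y \<Longrightarrow> R' x y" "\<not> orderable V R' b"
    "\<And>u v. u \<in> V \<Longrightarrow> v \<in> V \<Longrightarrow> u \<noteq> v \<Longrightarrow> \<not> R' u v \<Longrightarrow>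
       degree_in V R' u + degree_in V R' v + Suc b < card V"
proof -
  have "\<exists>R'. symp R' \<and> irreflp R' \<and> (\<forall>x y. R x y \<longrightarrow> R' x y) \<and> \<not> orderable V R' b \<and>
    (\<forall>u\<in>V. \<forall>v\<in>V. u \<noteq> v \<longrightarrow> \<not> R' u v \<longrightarrow> degree_in V R' u + degree_in V R' v + Suc b < card V)"
    using assms(2-4)
  \<comment> \<open>Each added edge lowers the number of nonadjacent ordered pairs.\<close>
  proof (induction "card {(x, y). x \<in> V \<and> y \<in> V \<and> \<not> R x y}" arbitrary: R rule: less_induct)
    case less
    show ?case
    proof (cases "\<forall>u\<in>V. \<forall>v\<in>V. u \<noteq> v \<longrightarrow> \<not> R u v \<longrightarrow>
        degree_in V R u + degree_in V R v + Suc b < card V")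
      case True
      then show ?thesis using less.prems by blast
    next
      case False
      then obtain u v where uv: "u \<in> V" "v \<in> V" "u \<noteq> v" "\<not> R u v"
        and deg: "card V \<le> degree_in V R u + degree_in V R v + Suc b" by (meson not_less)
      let ?R = "add_edge R u v"
      have R': "symp ?R" "irreflp ?R"
        using less.prems(1,2) uv(3)
        by (auto simp: add_edge_def insert_commute intro!: sympI irreflpI dest: sympD irreflpD)
      have no: "\<not> orderable V ?R b"
        using orderable_remove_edge[OF less.prems(1,2) uv(3) _ deg] less.prems(3) by blast
      have "card {(x, y). x \<in> V \<and> y \<in> V \<and> \<not> ?R x y} < card {(x, y). x \<in> V \<and> y \<in> V \<and> \<not> R x y}"
      proof (rule psubset_card_mono)
        show "finite {(x, y). x \<in> V \<and> y \<in> V \<and> \<not> R x y}"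
          by (rule finite_subset[of _ "V \<times> V"]) (use assms(1) in auto)
        have "(u, v) \<in> {(x, y). x \<in> V \<and> y \<in> V \<and> \<not> R x y} - {(x, y). x \<in> V \<and> y \<in> V \<and> \<not> ?R x y}"
          using uv by (auto simp: add_edge_def)
        then show "{(x, y). x \<in> V \<and> y \<in> V \<and> \<not> ?R x y} \<subset> {(x, y). x \<in> V \<and> y \<in> V \<and> \<not> R x y}"
          by (auto simp: add_edge_def)
      qed
      from less.hyps[OF this R' no] obtain R' where "symp R'" "irreflp R'"
        "\<forall>x y. ?R x y \<longrightarrow> R' x y" "\<not> orderable V R' b"
        "\<forall>u\<in>V. \<forall>v\<in>V. u \<noteq> v \<longrightarrow> \<not> R' u v \<longrightarrow> degree_in V R' u + degree_in V R' v + Suc b < card V"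
        by blast
      then show ?thesis by (intro exI[of _ R']) (auto simp: add_edge_def)
    qed
  qed
  then obtain R' where "symp R'" "irreflp R'" "\<forall>x y. R x y \<longrightarrow> R' x y" "\<not> orderable V R' b"
    "\<forall>u\<in>V. \<forall>v\<in>V. u \<noteq> v \<longrightarrow> \<not> R' u v \<longrightarrow> degree_in V R' u + degree_in V R' v + Suc b < card V"
    by (elim exE conjE)
  then show thesis by (intro that) auto
qed

lemma orderable_complete:
  assumes "finite V" "\<And>x y. x \<in> V \<Longrightarrow> y \<in> V \<Longrightarrow> x \<noteq> y \<Longrightarrow> R x y"
  shows "orderable V R b"
proof -
  obtain ws where "set ws = V" "distinct ws" using assms(1) finite_distinct_list by blast
  moreover from this have "breaks R ws = 0" using assms(2) by (intro breaks_complete) auto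
  ultimately show ?thesis unfolding orderable_def by (intro exI[of _ ws]) simp
qed

text \<open>Under the degree condition the closure is complete, and a complete graph has an ordering without
breaks.\<close>

lemma orderable_Ore:
  assumes "finite V" "symp R" "irreflp R"
    and "\<And>u v. u \<in> V \<Longrightarrow> v \<in> V \<Longrightarrow> u \<noteq> v \<Longrightarrow> \<not> R u v \<Longrightarrow>
       card V \<le> degree_in V R u + degree_in V R v + Suc b"
  shows "orderable V R b"
proof (rule ccontr)
  assume no: "\<not> orderable V R b"
  show False
  proof (rule path_closure[OF assms(1-3) no])
    fix R'
    assume R': "\<And>x y. R x y \<Longrightarrow> R' x y" and no': "\<not> orderable V R' b"
      and small: "\<And>u v. u \<in> V \<Longrightarrow> v \<in> V \<Longrightarrow> u \<noteq> v \<Longrightarrow> \<not> R' u v \<Longrightarrow>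
         degree_in V R' u + degree_in V R' v + Suc b < card V"
    have "orderable V R' b"
    proof (rule orderable_complete[OF assms(1)], rule ccontr)
      fix u v assume uv: "u \<in> V" "v \<in> V" "u \<noteq> v" "\<not> R' u v"
      then have "card V \<le> degree_in V R u + degree_in V R v + Suc b"
        by (intro assms(4)) (auto dest: R')
      moreover have "degree_in V R w \<le> degree_in V R' w" for w
        by (rule degree_in_mono[OF assms(1) R'])
      ultimately show False
        using small[OF uv] by (meson add_le_mono leD le_trans order_refl)
    qed
    then show False using no' by simp
  qed
qed

text \<open>A vertex joined to everything can be put into a break, which it repairs.\<close>

lemma orderable_insert:
  assumes R: "symp R" and "orderable V R b" "y \<notin> V" "\<And>x. x \<in> V \<Longrightarrow> R x y"
  shows "orderable (insert y V) R (b - 1)"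
proof -
  obtain ws where ws: "distinct ws" "set ws = V" "breaks R ws \<le> b"
    using assms(2) unfolding orderable_def by blast
  show ?thesis
  proof (cases "breaks R ws > 0")
    case False
    then have "breaks R (ws @ [y]) = 0"
      using False assms(4) ws by (cases "ws = []") (auto simp: breaks_append)
    then show ?thesis unfolding orderable_def using ws assms(3)
      by (intro exI[of _ "ws @ [y]"]) auto
  next
    case True
    then obtain xs x z zs where eq: "ws = xs @ x # z # zs" and n: "\<not> R x z"
      using breaks_split by blast
    have "breaks R ws = breaks R (xs @ [x]) + breaks R (z # zs) + 1"
      using breaks_append[of R "xs @ [x]" "z # zs"] eq n by simp
    moreover have "R x y" "R y z" using assms(4) R ws eq by (auto dest: sympD)
    then have "breaks R ((xs @ [x]) @ (y # z # zs)) = breaks R (xs @ [x]) + breaks R (z # zs)"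
      by (subst breaks_append) simp
    ultimately have "breaks R (xs @ x # y # z # zs) \<le> b - 1" using ws by simp
    then show ?thesis unfolding orderable_def using ws assms(3) eq
      by (intro exI[of _ "xs @ x # y # z # zs"]) auto
  qed
qed

lemma orderable_union_dominating:
  assumes R: "symp R" and "finite Y" and "orderable V R b" "Y \<inter> V = {}"
    and "\<And>x y. x \<in> V \<union> Y \<Longrightarrow> y \<in> Y \<Longrightarrow> x \<noteq> y \<Longrightarrow> R x y"
  shows "orderable (V \<union> Y) R (b - card Y)"
  using assms(2-5)
proof (induction Y)
  case (insert y Y)
  have "orderable (V \<union> Y) R (b - card Y)"
    by (rule insert.IH) (use insert.prems in auto)
  then have "orderable (insert y (V \<union> Y)) R (b - card Y - 1)"
    by (rule orderable_insert[OF R]) (use insert.prems insert.hyps in auto)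
  then show ?case using insert.hyps by simp
qed simp

lemma orderable_Un:
  assumes "orderable V R b" "orderable W R c" "V \<inter> W = {}"
  shows "orderable (V \<union> W) R (b + c + 1)"
proof -
  obtain vs ws where "distinct vs" "set vs = V" "breaks R vs \<le> b"
    "distinct ws" "set ws = W" "breaks R ws \<le> c"
    using assms(1,2) unfolding orderable_def by blast
  then show ?thesis unfolding orderable_def using assms(3)
    by (intro exI[of _ "vs @ ws"]) (auto simp: breaks_append)
qed

section \<open>Dense graphs without an ordering with few breaks\<close>

lemma degree_plus_nonneighbours_less_card:
  assumes "finite V" "irreflp R" "v \<in> V" and S: "S \<subseteq> V - {v}"
  shows "degree_in V R v + card {w \<in> S. \<not> R v w} < card V"
proof -
  have "{w \<in> V. R v w} \<inter> {w \<in> S. \<not> R v w} = {}" by auto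
  moreover have "finite S" using S assms(1) by (metis finite_Diff finite_subset)
  ultimately have "degree_in V R v + card {w \<in> S. \<not> R v w}
      = card ({w \<in> V. R v w} \<union> {w \<in> S. \<not> R v w})"
    unfolding degree_in_def using assms(1) by (subst card_Un_disjoint) auto
  also have "\<dots> < card V"
    using assms by (intro psubset_card_mono) (auto dest: irreflpD)
  finally show ?thesis .
qed

text \<open>Let \<open>S\<close> consist of the vertices with degree below \<open>(n - k) / 2\<close>. The other vertices have pairwise
degree sum at least \<open>n - k\<close>, so they form a clique and every missing edge has an end in \<open>S\<close>.
The bound on \<open>S\<close> is reached in three steps. Each vertex of \<open>S\<close> misses at least \<open>n / 2\<close> others, so \<open>S\<close> has at most \<open>4 * (d + k)\<close>
vertices. Hence clique vertices have degree at least \<open>n - |S| - 1\<close>, and the closure condition with a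
clique vertex pushes the degrees in \<open>S\<close> down to \<open>|S| - k\<close>. Now each vertex of \<open>S\<close> misses nearly
all others, and counting again, with the missing pairs between \<open>S\<close> and the clique seen from both
sides, leaves at most \<open>d + k\<close> vertices.\<close>

lemma closed_graph_low_degree_vertices:
  fixes n k d :: nat
  assumes V: "finite V" "card V = n" and R: "symp R" "irreflp R"
    and k: "k \<ge> 1" and large: "(d + k + 1) * (12 * d + 12 * k + 1) < 2 * n"
    and closed: "\<And>u v. u \<in> V \<Longrightarrow> v \<in> V \<Longrightarrow> u \<noteq> v \<Longrightarrow> \<not> R u v \<Longrightarrow>
       degree_in V R u + degree_in V R v + k < n"
    and sum: "n * (n - 1) \<le> (\<Sum>v\<in>V. degree_in V R v) + 2 * (d + k) * n"
  obtains S where "S \<subseteq> V" "card S \<le> d + k"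
    "\<And>u v. u \<in> V - S \<Longrightarrow> v \<in> V - S \<Longrightarrow> u \<noteq> v \<Longrightarrow> R u v"
    "\<And>v. v \<in> S \<Longrightarrow> degree_in V R v + k \<le> card S"
proof -
  define deg where "deg = degree_in V R"
  define S where "S = {v \<in> V. 2 * deg v + k < n}"
  define s where "s = card S"
  have SV: "S \<subseteq> V" and fS: "finite S" using V by (auto simp: S_def)
  have clique: "R u v" if "u \<in> V - S" "v \<in> V - S" "u \<noteq> v" for u v
  proof (rule ccontr)
    assume "\<not> R u v"
    then have "deg u + deg v + k < n" using closed[of u v] that by (auto simp: deg_def)
    then show False using that by (auto simp: S_def)
  qed
  \<comment> \<open>With the coarse bound on \<open>S\<close> this keeps \<open>2 * |S|\<close> below \<open>n\<close>.\<close>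
  have n8: "8 * (d + k) < n"
  proof -
    have "2 * (12 * d + 12 * k + 1) \<le> (d + k + 1) * (12 * d + 12 * k + 1)"
      using k by (intro mult_right_mono) auto
    then show ?thesis using large by simp
  qed
  have deg_less: "deg v < n" if "v \<in> V" for v
    using degree_plus_nonneighbours_less_card[OF V(1) R(2) that, of "{}"] V by (simp add: deg_def)
  have total: "(\<Sum>v\<in>V. n - 1 - deg v) \<le> 2 * (d + k) * n"
  proof -
    have "(\<Sum>v\<in>V. n - 1 - deg v) + (\<Sum>v\<in>V. deg v) = (\<Sum>v\<in>V. n - 1)"
      unfolding sum.distrib[symmetric]
      by (rule sum.cong[OF refl]) (use deg_less in fastforce)
    then have "(\<Sum>v\<in>V. n - 1 - deg v) + (\<Sum>v\<in>V. deg v) = n * (n - 1)" using V by simp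
    then show ?thesis using sum unfolding deg_def by linarith
  qed
  have "s * n = (\<Sum>v\<in>S. n)" by (simp add: s_def)
  also have "\<dots> \<le> (\<Sum>v\<in>S. 2 * (n - 1 - deg v))"
    by (rule sum_mono) (use k in \<open>auto simp: S_def\<close>)
  also have "\<dots> \<le> (\<Sum>v\<in>V. 2 * (n - 1 - deg v))" using V SV by (intro sum_mono2) auto
  also have "\<dots> = 2 * (\<Sum>v\<in>V. n - 1 - deg v)" by (rule sum_distrib_left[symmetric])
  also have "\<dots> \<le> 2 * (2 * (d + k) * n)" using total by (rule mult_left_mono) simp
  finally have "s * n \<le> (4 * (d + k)) * n" by (simp add: algebra_simps)
  then have s4: "s \<le> 4 * (d + k)" using n8 by simp
  have card_VS: "card (V - S) = n - s" using V SV fS by (simp add: card_Diff_subset s_def)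
  have s_n: "s \<le> n" using V SV card_mono s_def by metis
  have deg_VS: "n \<le> deg u + s + 1" if "u \<in> V - S" for u
  proof -
    have "card (V - S - {u}) \<le> deg u" unfolding deg_def degree_in_def
      using clique that V by (intro card_mono) auto
    then show ?thesis using that card_VS V by simp
  qed
  have deg_S: "deg v + k \<le> s" if v: "v \<in> S" for v
  proof -
    have "\<not> V - S \<subseteq> {w \<in> V. R v w}"
    proof
      assume "V - S \<subseteq> {w \<in> V. R v w}"
      then have "n - s \<le> deg v"
        using card_mono[of "{w \<in> V. R v w}" "V - S"] V card_VS by (simp add: deg_def degree_in_def)
      moreover have "2 * deg v + k < n" using v by (simp add: S_def)
      ultimately show False using s4 n8 by linarith
    qed
    then obtain u where u: "u \<in> V - S" "\<not> R v u" by auto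
    then have "deg v + deg u + k < n" using v SV closed[of v u] by (auto simp: deg_def)
    then show ?thesis using deg_VS[OF u(1)] by linarith
  qed
  have nonadj: "int n - int s - int (deg v) \<le> int (card {u \<in> V - S. \<not> R v u})" for v
  proof -
    have "V - S \<subseteq> {u \<in> V - S. \<not> R v u} \<union> {w \<in> V. R v w}" by auto
    then have "card (V - S) \<le> card ({u \<in> V - S. \<not> R v u} \<union> {w \<in> V. R v w})"
      using V by (intro card_mono) auto
    also have "\<dots> \<le> card {u \<in> V - S. \<not> R v u} + deg v"
      unfolding deg_def degree_in_def by (rule card_Un_le)
    finally show ?thesis using card_VS by linarith
  qed
  have "int (\<Sum>v\<in>V. n - 1 - deg v) = int (\<Sum>v\<in>S. n - 1 - deg v) + int (\<Sum>u\<in>V - S. n - 1 - deg u)"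
    using V SV by (simp add: sum.subset_diff)
  note split = this
  \<comment> \<open>The missing pairs, counted with order: first those starting in \<open>S\<close>, then those from the clique to \<open>S\<close>.\<close>
  have low: "int s * (int n - 1 - (int s - int k)) \<le> int (\<Sum>v\<in>S. n - 1 - deg v)"
    unfolding s_def of_nat_sum
  proof (rule sum_bounded_below)
    fix v assume "v \<in> S"
    then show "int n - 1 - (int (card S) - int k) \<le> int (n - 1 - deg v)"
      using deg_S[of v] s_def by linarith
  qed
  have high: "int s * (int n - int s - (int s - int k)) \<le> int (\<Sum>u\<in>V - S. n - 1 - deg u)"
  proof -
    have "int s * (int n - int s - (int s - int k)) \<le> (\<Sum>v\<in>S. int (card {u \<in> V - S. \<not> R v u}))"
      unfolding s_def
    proof (rule sum_bounded_below)
      fix v assume "v \<in> S"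
      then show "int n - int (card S) - (int (card S) - int k) \<le> int (card {u \<in> V - S. \<not> R v u})"
        using deg_S[of v] nonadj[of v] s_def by linarith
    qed
    also have "\<dots> = int (\<Sum>v\<in>S. card {u \<in> V - S. \<not> R v u})" by simp
    also have "(\<Sum>v\<in>S. card {u \<in> V - S. \<not> R v u}) = (\<Sum>u\<in>V - S. card {v \<in> S. \<not> R v u})"
      using sum_multicount_gen[of "S" "V - S" "\<lambda>v u. \<not> R v u" "\<lambda>u. card {v \<in> S. \<not> R v u}"] fS V by simp
    also have "\<dots> \<le> (\<Sum>u\<in>V - S. n - 1 - deg u)"
    proof (rule sum_mono)
      fix u assume u: "u \<in> V - S"
      have "{v \<in> S. \<not> R v u} = {v \<in> S. \<not> R u v}" using R by (auto dest: sympD)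
      moreover have "deg u + card {v \<in> S. \<not> R u v} < n"
        using degree_plus_nonneighbours_less_card[OF V(1) R(2), of u S] u SV V by (auto simp: deg_def)
      ultimately show "card {v \<in> S. \<not> R v u} \<le> n - 1 - deg u" by simp
    qed
    finally show ?thesis by simp
  qed
  have main: "int s * (2 * int n - 1 - 3 * int s + 2 * int k) \<le> 2 * (int d + int k) * int n"
  proof -
    have "int (\<Sum>v\<in>V. n - 1 - deg v) \<le> int (2 * (d + k) * n)" using total by (simp only: of_nat_le_iff)
    with split low high have "int s * (int n - 1 - (int s - int k)) + int s * (int n - int s - (int s - int k))
        \<le> int (2 * (d + k) * n)" by linarith
    then show ?thesis by (simp add: algebra_simps)
  qed
  have s_le: "s \<le> d + k"
  proof (rule ccontr)
    assume "\<not> s \<le> d + k"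
    define t where "t = s - (d + k)"
    have t: "s = d + k + t" "t \<ge> 1" using \<open>\<not> s \<le> d + k\<close> by (auto simp: t_def)
    have "2 * int t * int n \<le> int s * (3 * int s + 1 - 2 * int k)"
      using main unfolding t by (simp add: algebra_simps)
    also have "\<dots> \<le> int s * (12 * int d + 12 * int k + 1)"
      using s4 by (intro mult_left_mono) auto
    also have "\<dots> \<le> (int t * (int d + int k + 1)) * (12 * int d + 12 * int k + 1)"
    proof (rule mult_right_mono)
      have "(int d + int k) * 1 \<le> (int d + int k) * int t" using t(2) by (intro mult_left_mono) auto
      then show "int s \<le> int t * (int d + int k + 1)" unfolding t by (simp add: algebra_simps)
    qed simp
    finally have "int t * (2 * int n) \<le> int t * ((int d + int k + 1) * (12 * int d + 12 * int k + 1))"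
      by (simp add: mult_ac)
    then have "2 * int n \<le> (int d + int k + 1) * (12 * int d + 12 * int k + 1)"
      using t(2) by (simp add: mult_le_cancel_left)
    then have "int (2 * n) \<le> int ((d + k + 1) * (12 * d + 12 * k + 1))"
      by (simp add: algebra_simps)
    then show False using large by linarith
  qed
  show thesis
    by (rule that[OF SV s_le[unfolded s_def] clique deg_S[unfolded s_def deg_def]])
qed

text \<open>In the closure every vertex of \<open>S\<close> has degree exactly \<open>d\<close> and \<open>S\<close> has exactly \<open>d + k\<close> vertices,
because the minimum degree meets the upper bounds of the previous lemma. A clique vertex with one
neighbour in \<open>S\<close> has so large a degree that the closure condition joins it to all of \<open>S\<close>; let \<open>Y\<close>
consist of these vertices. With \<open>|Y| = d\<close> they use up all degrees in \<open>S\<close>, which is the claimed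
structure. Fewer would leave a regular graph of degree \<open>d - |Y|\<close> on \<open>S\<close>, and then the closure would
be orderable: Ore's condition orders \<open>S\<close> with at most \<open>|Y| + k - 2\<close> breaks, appending the rest of
the clique costs one more, and each vertex of \<open>Y\<close> repairs one.\<close>

lemma dense_nonorderable_structure:
  fixes n k d :: nat
  assumes V: "finite V" "card V = n" and R: "symp R" "irreflp R"
    and k: "k \<ge> 1" and large: "(d + k + 1) * (12 * d + 12 * k + 1) < 2 * n"
    and mindeg: "\<And>v. v \<in> V \<Longrightarrow> d \<le> degree_in V R v"
    and sum: "n * (n - 1) \<le> (\<Sum>v\<in>V. degree_in V R v) + 2 * (d + k) * n"
    and conn: "\<And>S. S \<subseteq> V \<Longrightarrow> S \<noteq> {} \<Longrightarrow> S \<noteq> V \<Longrightarrow> \<exists>x\<in>S. \<exists>y\<in>V - S. R x y"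
    and no: "\<not> orderable V R (k - 1)"
  obtains S Y where "S \<subseteq> V" "Y \<subseteq> V - S" "card S = d + k" "card Y = d"
    "\<And>x y. x \<in> S \<Longrightarrow> y \<in> V - Y \<Longrightarrow> \<not> R x y"
proof (rule path_closure[OF V(1) R no])
  fix H
  assume H: "symp H" "irreflp H" and RH: "\<And>x y. R x y \<Longrightarrow> H x y" and noH: "\<not> orderable V H (k - 1)"
    and closed': "\<And>u v. u \<in> V \<Longrightarrow> v \<in> V \<Longrightarrow> u \<noteq> v \<Longrightarrow> \<not> H u v \<Longrightarrow>
       degree_in V H u + degree_in V H v + Suc (k - 1) < card V"
  have closed: "\<And>u v. u \<in> V \<Longrightarrow> v \<in> V \<Longrightarrow> u \<noteq> v \<Longrightarrow> \<not> H u v \<Longrightarrow>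
       degree_in V H u + degree_in V H v + k < n"
    using closed' k V by simp
  have degH: "degree_in V R v \<le> degree_in V H v" for v
    by (rule degree_in_mono[OF V(1) RH])
  have sumH: "n * (n - 1) \<le> (\<Sum>v\<in>V. degree_in V H v) + 2 * (d + k) * n"
  proof -
    have "(\<Sum>v\<in>V. degree_in V R v) \<le> (\<Sum>v\<in>V. degree_in V H v)" by (rule sum_mono) (rule degH)
    then show ?thesis using sum by linarith
  qed
  show thesis
  proof (rule closed_graph_low_degree_vertices[OF V H k large closed sumH])
    fix S
    assume SV: "S \<subseteq> V" and s: "card S \<le> d + k"
      and clique: "\<And>u v. u \<in> V - S \<Longrightarrow> v \<in> V - S \<Longrightarrow> u \<noteq> v \<Longrightarrow> H u v"
      and degS: "\<And>v. v \<in> S \<Longrightarrow> degree_in V H v + k \<le> card S"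
    have fS: "finite S" using SV V finite_subset by blast
    have ne: "S \<noteq> {}"
      using noH orderable_complete[OF V(1), of H] clique by auto
    have degS_ge: "d \<le> degree_in V H v" if "v \<in> S" for v
      using mindeg[of v] degH[of v] that SV by force
    obtain v0 where v0: "v0 \<in> S" using ne by blast
    have cS: "card S = d + k" using degS[OF v0] degS_ge[OF v0] s by linarith
    have degS': "degree_in V H v = d" if "v \<in> S" for v
      using degS[OF that] degS_ge[OF that] cS by linarith
    have nS: "card S < n"
    proof -
      have "1 * (2 * (d + k)) \<le> (d + k + 1) * (12 * d + 12 * k + 1)"
        by (intro mult_mono) auto
      also note large
      finally show ?thesis using cS by simp
    qed
    define Y where "Y = {u \<in> V - S. \<exists>v\<in>S. H u v}"
    have YV: "Y \<subseteq> V - S" and fY: "finite Y" using V by (auto simp: Y_def)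
    have full: "H v u" if u: "u \<in> Y" and v: "v \<in> S" for u v
    proof (rule ccontr)
      assume n': "\<not> H v u"
      obtain w where w: "w \<in> S" "H u w" using u by (auto simp: Y_def)
      have "insert w (V - S - {u}) \<subseteq> {x \<in> V. H u x}" using clique u w SV by (auto simp: Y_def)
      then have "card (insert w (V - S - {u})) \<le> degree_in V H u"
        unfolding degree_in_def using V by (intro card_mono) auto
      moreover have "card (insert w (V - S - {u})) = n - card S"
        using w u V SV fS nS by (auto simp: Y_def card_Diff_subset)
      moreover have "degree_in V H v + degree_in V H u + k < n"
        using closed[of v u] n' u v SV by (auto simp: Y_def)
      ultimately show False using degS'[OF v] cS nS by linarith
    qed
    have nbr: "{w \<in> V. H v w} = Y \<union> {w \<in> S. H v w}" if "v \<in> S" for v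
      using full that SV H by (auto simp: Y_def dest: sympD)
    have deg_split: "card Y + degree_in S H v = d" if "v \<in> S" for v
    proof -
      have "card (Y \<union> {w \<in> S. H v w}) = card Y + degree_in S H v"
        unfolding degree_in_def using fY fS YV by (subst card_Un_disjoint) auto
      then show ?thesis using degS'[OF that] nbr[OF that] by (simp add: degree_in_def)
    qed
    have "card Y = d"
    proof (rule ccontr)
      assume "card Y \<noteq> d"
      then have less: "card Y < d" using deg_split[OF v0] by linarith
      \<comment> \<open>Connectedness rules out \<open>Y = {}\<close>, so the subtraction \<open>card Y + k - 2\<close> below is not truncated.\<close>
      obtain x y where "x \<in> S" "y \<in> V - S" "R x y"
        using conn[OF SV ne] nS V by auto
      then have "y \<in> Y" using RH H by (auto simp: Y_def dest: sympD)
      then have pos: "card Y \<ge> 1" using fY by (auto simp: Suc_le_eq card_gt_0_iff)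
      have "orderable S H (card Y + k - 2)"
      proof (rule orderable_Ore[OF fS H])
        fix u v assume "u \<in> S" "v \<in> S"
        then show "card S \<le> degree_in S H u + degree_in S H v + Suc (card Y + k - 2)"
          using deg_split[of u] deg_split[of v] cS less pos k by linarith
      qed
      moreover have "orderable (V - S - Y) H 0"
        using V clique by (intro orderable_complete) auto
      ultimately have "orderable (S \<union> (V - S - Y)) H (card Y + k - 2 + 0 + 1)"
        by (rule orderable_Un) auto
      then have "orderable ((S \<union> (V - S - Y)) \<union> Y) H (card Y + k - 2 + 0 + 1 - card Y)"
      proof (rule orderable_union_dominating[OF H(1) fY])
        show "Y \<inter> (S \<union> (V - S - Y)) = {}" using YV by auto
        fix x y assume "x \<in> (S \<union> (V - S - Y)) \<union> Y" "y \<in> Y" "x \<noteq> y"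
        then show "H x y" using full[of y x] clique[of x y] YV by blast
      qed
      moreover have "(S \<union> (V - S - Y)) \<union> Y = V" using SV YV by auto
      moreover have "card Y + k - 2 + 0 + 1 - card Y = k - 1" using pos k by linarith
      ultimately show False using noH by simp
    qed
    moreover have "\<not> R x y" if "x \<in> S" "y \<in> V - Y" for x y
    proof
      assume "R x y"
      have "degree_in S H x = 0" using deg_split[OF that(1)] \<open>card Y = d\<close> by linarith
      then have "{w \<in> S. H x w} = {}" using fS by (auto simp: degree_in_def)
      then show False using nbr[OF that(1)] that RH[OF \<open>R x y\<close>] by blast
    qed
    ultimately show thesis using that[OF SV YV cS] by blast
  qed
qed

section \<open>Degrees and the Q-index\<close>

abbreviation adjacent :: "'a graph \<Rightarrow> 'a \<Rightarrow> 'a \<Rightarrow> bool" where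
  "adjacent G u v \<equiv> {u, v} \<in> edges G"

lemma symp_adjacent: "symp (adjacent G)"
  by (auto simp: symp_def insert_commute)

lemma irreflp_adjacent: "simple_graph G \<Longrightarrow> irreflp (adjacent G)"
  by (auto simp: irreflp_def simple_graph_def)

lemma vdegree_eq_degree_in:
  assumes "simple_graph G" "v \<in> verts G"
  shows "vdegree G v = degree_in (verts G) (adjacent G) v"
proof -
  have "bij_betw (\<lambda>w. {v, w}) {w \<in> verts G. adjacent G v w} {e \<in> edges G. v \<in> e}"
    unfolding bij_betw_def
  proof
    show "inj_on (\<lambda>w. {v, w}) {w \<in> verts G. adjacent G v w}"
      by (auto simp: inj_on_def doubleton_eq_iff)
    show "(\<lambda>w. {v, w}) ` {w \<in> verts G. adjacent G v w} = {e \<in> edges G. v \<in> e}"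
    proof (intro equalityI subsetI)
      fix e assume e: "e \<in> {e \<in> edges G. v \<in> e}"
      then have "card e = 2" "e \<subseteq> verts G" using assms(1) by (auto simp: simple_graph_def)
      then obtain a b where ab: "e = {a, b}" "a \<noteq> b" by (auto simp: card_2_iff)
      define w where "w = (if a = v then b else a)"
      have "e = {v, w}" using ab e by (auto simp: w_def)
      then show "e \<in> (\<lambda>w. {v, w}) ` {w \<in> verts G. adjacent G v w}"
        using e \<open>e \<subseteq> verts G\<close> by auto
    qed auto
  qed
  then show ?thesis unfolding vdegree_def degree_in_def by (rule bij_betw_same_card[symmetric])
qed

text \<open>Over the complex numbers some eigenvalue \<open>\<mu>\<close> exists, with eigenvector \<open>v\<close>. It is real, since the
Hermitian form of \<open>A\<close> at \<open>v\<close> is real and equals \<open>\<mu>\<close> times the squared norm of \<open>v\<close>; being real, it is a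
root of the characteristic polynomial of \<open>A\<close> itself.\<close>

lemma symmetric_real_mat_eigenvalue_ex:
  fixes A :: "real mat"
  assumes A: "A \<in> carrier_mat n n" and n: "n > 0"
    and sym: "\<And>i j. i < n \<Longrightarrow> j < n \<Longrightarrow> A $$ (i, j) = A $$ (j, i)"
  shows "\<exists>x. eigenvalue A x"
proof -
  let ?C = "map_mat complex_of_real A"
  have C: "?C \<in> carrier_mat n n" using A by simp
  obtain \<mu> where mu: "eigenvalue ?C \<mu>" using spectrum_non_empty[OF C n] by (auto simp: spectrum_def)
  then obtain v where "eigenvector ?C v \<mu>" unfolding eigenvalue_def ..
  then have v: "v \<in> carrier_vec n" "v \<noteq> 0\<^sub>v n" "?C *\<^sub>v v = \<mu> \<cdot>\<^sub>v v"
    unfolding eigenvector_def carrier_matD(1)[OF C] by blast+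
  have row: "(\<Sum>j<n. of_real (A $$ (i, j)) * v $ j) = \<mu> * v $ i" if i: "i < n" for i
  proof -
    have "(?C *\<^sub>v v) $ i = (\<Sum>j<n. of_real (A $$ (i, j)) * v $ j)"
      using A v(1) i by (simp add: scalar_prod_def lessThan_atLeast0)
    then show ?thesis using v i by simp
  qed
  define N where "N = (\<Sum>i<n. cnj (v $ i) * v $ i)"
  have N: "\<mu> * N = (\<Sum>i<n. \<Sum>j<n. cnj (v $ i) * of_real (A $$ (i, j)) * v $ j)"
  proof -
    have "\<mu> * N = (\<Sum>i<n. cnj (v $ i) * (\<mu> * v $ i))"
      unfolding N_def sum_distrib_left by (simp add: mult_ac)
    also have "\<dots> = (\<Sum>i<n. cnj (v $ i) * (\<Sum>j<n. of_real (A $$ (i, j)) * v $ j))"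
      using row by simp
    finally show ?thesis by (simp add: sum_distrib_left mult_ac)
  qed
  have "cnj (\<mu> * N) = (\<Sum>i<n. \<Sum>j<n. cnj (v $ j) * of_real (A $$ (j, i)) * v $ i)"
    unfolding N by (simp add: mult_ac sym)
  also have "\<dots> = \<mu> * N" unfolding N by (rule sum.swap)
  finally have "cnj (\<mu> * N) = \<mu> * N" .
  moreover have "cnj N = N" by (simp add: N_def mult.commute)
  moreover have "N \<noteq> 0"
  proof
    assume "N = 0"
    have "N = of_real (\<Sum>i<n. (cmod (v $ i))\<^sup>2)"
      unfolding N_def of_real_sum
      by (intro sum.cong refl) (metis complex_norm_square mult.commute)
    then have "complex_of_real (\<Sum>i<n. (cmod (v $ i))\<^sup>2) = 0" using \<open>N = 0\<close> by metis
    then have "(\<Sum>i<n. (cmod (v $ i))\<^sup>2) = 0" by (simp only: of_real_eq_0_iff)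
    then have "\<forall>i<n. v $ i = 0" by (simp add: sum_nonneg_eq_0_iff)
    then have "v = 0\<^sub>v n" using v(1) by (intro eq_vecI) auto
    then show False using v(2) by simp
  qed
  ultimately have "cnj \<mu> = \<mu>" by simp
  then have real: "\<mu> = of_real (Re \<mu>)" by (simp add: complex_eq_iff)
  have "poly (char_poly ?C) (of_real (Re \<mu>)) = 0"
    using mu real eigenvalue_root_char_poly[OF C] by simp
  then have "of_real (poly (char_poly A) (Re \<mu>)) = (0 :: complex)"
    by (simp add: of_real_hom.char_poly_hom[OF A])
  then show ?thesis using eigenvalue_root_char_poly[OF A] by auto
qed

lemma vertex_list:
  assumes "simple_graph G"
  shows "distinct (vertex_list G)" "set (vertex_list G) = verts G"
    "length (vertex_list G) = card (verts G)"
proof -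
  have "finite (verts G)" using assms by (simp add: simple_graph_def)
  from finite_distinct_list[OF this] have "\<exists>vs. distinct vs \<and> set vs = verts G" by auto
  then have *: "distinct (vertex_list G) \<and> set (vertex_list G) = verts G"
    unfolding vertex_list_def by (rule someI_ex)
  from * show "distinct (vertex_list G)" ..
  from * show "set (vertex_list G) = verts G" ..
  from * show "length (vertex_list G) = card (verts G)"
    using distinct_card[of "vertex_list G"] by simp
qed

lemma signless_laplacian_carrier:
  "signless_laplacian G \<in> carrier_mat (card (verts G)) (card (verts G))"
  by (simp add: signless_laplacian_def degree_matrix_def adjacency_matrix_def Let_def)

lemma signless_laplacian_entry:
  assumes "i < card (verts G)" "j < card (verts G)"
  shows "signless_laplacian G $$ (i, j) =
    (if i = j then real (vdegree G (vertex_list G ! i)) else 0) +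
    (if adjacent G (vertex_list G ! i) (vertex_list G ! j) then 1 else 0)"
  using assms by (simp add: signless_laplacian_def degree_matrix_def adjacency_matrix_def Let_def)

text \<open>The maximum in \<open>Q_index\<close> is attained because the spectrum is finite and, by symmetry of the matrix,
not empty.\<close>

lemma Q_index_eigenvalue:
  assumes "simple_graph G" "verts G \<noteq> {}"
  shows "eigenvalue (signless_laplacian G) (Q_index G)"
proof -
  have pos: "card (verts G) > 0" using assms by (auto simp: simple_graph_def card_gt_0_iff)
  note C = signless_laplacian_carrier[of G]
  have "\<exists>x. eigenvalue (signless_laplacian G) x"
    by (rule symmetric_real_mat_eigenvalue_ex[OF C pos])
      (auto simp: signless_laplacian_entry insert_commute)
  moreover have "finite {x. eigenvalue (signless_laplacian G) x}"
    using card_finite_spectrum(1)[OF C] by (simp add: spectrum_def)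
  ultimately have "Max {x. eigenvalue (signless_laplacian G) x} \<in> {x. eigenvalue (signless_laplacian G) x}"
    by (intro Max_in) auto
  then show ?thesis by (simp add: Q_index_def)
qed

text \<open>The eigenvector equation moved from matrix indices to vertices.\<close>

lemma signless_laplacian_eigenfunction:
  assumes G: "simple_graph G" and ev: "eigenvalue (signless_laplacian G) q"
  shows "\<exists>f. (\<exists>v\<in>verts G. f v \<noteq> 0) \<and> (\<forall>v\<in>verts G.
       real (vdegree G v) * f v + (\<Sum>w\<in>{w \<in> verts G. adjacent G v w}. f w) = q * f v)"
proof -
  let ?n = "card (verts G)" and ?vs = "vertex_list G"
  note vs = vertex_list[OF G]
  have fin: "finite (verts G)" using G by (simp add: simple_graph_def)
  obtain x where "eigenvector (signless_laplacian G) x q" using ev unfolding eigenvalue_def ..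
  then have x: "x \<in> carrier_vec ?n" "x \<noteq> 0\<^sub>v ?n" "signless_laplacian G *\<^sub>v x = q \<cdot>\<^sub>v x"
    unfolding eigenvector_def carrier_matD(1)[OF signless_laplacian_carrier[of G]] by blast+
  have bij: "bij_betw ((!) ?vs) {..<?n} (verts G)"
    by (rule bij_betw_nth[OF vs(1) _ vs(2)[symmetric]]) (simp only: vs(3))
  define f where "f v = x $ the_inv_into {..<?n} ((!) ?vs) v" for v
  have f: "f (?vs ! i) = x $ i" if "i < ?n" for i
    unfolding f_def using that bij_betw_imp_inj_on[OF bij] by (subst the_inv_into_f_f) auto
  obtain i where i: "i < ?n" "x $ i \<noteq> 0"
    using x(1,2) by (metis carrier_vecD eq_vecI index_zero_vec)
  show ?thesis
  proof (intro exI[of _ f] conjI ballI)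
    show "\<exists>v\<in>verts G. f v \<noteq> 0"
      using i f[OF i(1)] bij by (intro bexI[of _ "?vs ! i"]) (auto simp: bij_betw_def)
    fix v assume "v \<in> verts G"
    then obtain i where i: "i < ?n" "v = ?vs ! i" using bij by (auto simp: bij_betw_def)
    have "q * f v = (signless_laplacian G *\<^sub>v x) $ i" using x i f by simp
    also have "\<dots> = (\<Sum>j<?n. signless_laplacian G $$ (i, j) * x $ j)"
      using signless_laplacian_carrier[of G] x(1) i(1)
      by (simp add: scalar_prod_def lessThan_atLeast0)
    also have "\<dots> = (\<Sum>j<?n. (if i = j then real (vdegree G v) * f v else 0)
        + (if adjacent G v (?vs ! j) then f (?vs ! j) else 0))"
      by (intro sum.cong refl) (use i f in \<open>auto simp: signless_laplacian_entry algebra_simps\<close>)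
    also have "\<dots> = real (vdegree G v) * f v + (\<Sum>j<?n. if adjacent G v (?vs ! j) then f (?vs ! j) else 0)"
      using i(1) by (simp add: sum.distrib)
    also have "(\<Sum>j<?n. if adjacent G v (?vs ! j) then f (?vs ! j) else 0)
        = (\<Sum>w\<in>verts G. if adjacent G v w then f w else 0)"
      by (rule sum.reindex_bij_betw[OF bij])
    also have "\<dots> = (\<Sum>w\<in>{w \<in> verts G. adjacent G v w}. f w)"
      using fin by (simp add: sum.inter_filter)
    finally show "real (vdegree G v) * f v + (\<Sum>w\<in>{w \<in> verts G. adjacent G v w}. f w) = q * f v" ..
  qed
qed

text \<open>Merris' bound: an eigenvalue is at most the degree of some vertex plus the average degree of its
neighbours. Conjugating by the degree matrix means writing an eigenfunction as \<open>f v = d v * g v\<close>; the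
bound is the eigenvalue equation at a vertex where \<open>\<bar>g\<bar>\<close> is largest.\<close>

lemma signless_laplacian_eigenvalue_bound:
  assumes G: "simple_graph G" and ev: "eigenvalue (signless_laplacian G) q"
    and pos: "\<And>v. v \<in> verts G \<Longrightarrow> vdegree G v > 0"
  shows "\<exists>v\<in>verts G. q * real (vdegree G v) \<le> (real (vdegree G v))\<^sup>2 +
       (\<Sum>w\<in>{w \<in> verts G. adjacent G v w}. real (vdegree G w))"
proof -
  have fin: "finite (verts G)" using G by (simp add: simple_graph_def)
  define d where "d v = real (vdegree G v)" for v
  have dpos: "d v > 0" if "v \<in> verts G" for v using pos[OF that] by (simp add: d_def)
  obtain f where f0: "\<exists>v\<in>verts G. f v \<noteq> 0"
    and f: "\<And>v. v \<in> verts G \<Longrightarrow> d v * f v + (\<Sum>w\<in>{w \<in> verts G. adjacent G v w}. f w) = q * f v"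
    using signless_laplacian_eigenfunction[OF G ev, folded d_def] by auto
  define g where "g v = f v / d v" for v
  have fg: "f v = d v * g v" if "v \<in> verts G" for v using dpos[OF that] by (simp add: g_def)
  have "\<exists>v\<in>verts G. \<forall>w\<in>verts G. \<bar>g w\<bar> \<le> \<bar>g v\<bar>"
  proof -
    have "Max ((\<lambda>v. \<bar>g v\<bar>) ` verts G) \<in> (\<lambda>v. \<bar>g v\<bar>) ` verts G"
      using fin f0 by (intro Max_in) auto
    then obtain v where v: "v \<in> verts G" "\<bar>g v\<bar> = Max ((\<lambda>v. \<bar>g v\<bar>) ` verts G)" by auto
    then show ?thesis using fin by (intro bexI[of _ v]) auto
  qed
  then obtain v where v: "v \<in> verts G" and max: "\<And>w. w \<in> verts G \<Longrightarrow> \<bar>g w\<bar> \<le> \<bar>g v\<bar>" by blast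
  have gpos: "\<bar>g v\<bar> > 0"
  proof -
    obtain w where w: "w \<in> verts G" "f w \<noteq> 0" using f0 by blast
    then have "g w \<noteq> 0" using fg by auto
    then show ?thesis using max[OF w(1)] by linarith
  qed
  let ?N = "{w \<in> verts G. adjacent G v w}"
  have "\<bar>\<Sum>w\<in>?N. f w\<bar> \<le> (\<Sum>w\<in>?N. \<bar>f w\<bar>)" by (rule sum_abs)
  also have "\<dots> \<le> (\<Sum>w\<in>?N. d w * \<bar>g v\<bar>)"
  proof (rule sum_mono)
    fix w assume "w \<in> ?N"
    then have "w \<in> verts G" by simp
    then show "\<bar>f w\<bar> \<le> d w * \<bar>g v\<bar>"
      using fg[of w] max[of w] dpos[of w] by (simp add: abs_mult mult_left_mono)
  qed
  finally have sumN: "\<bar>\<Sum>w\<in>?N. f w\<bar> \<le> (\<Sum>w\<in>?N. d w) * \<bar>g v\<bar>" by (simp add: sum_distrib_right)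
  have "q * d v * \<bar>g v\<bar> = q * \<bar>f v\<bar>" using fg[OF v] dpos[OF v] by (simp add: abs_mult)
  also have "\<dots> \<le> \<bar>q * f v\<bar>" by (simp add: abs_mult mult_right_mono)
  also have "\<dots> \<le> \<bar>d v * f v\<bar> + \<bar>\<Sum>w\<in>?N. f w\<bar>" using f[OF v] abs_triangle_ineq by metis
  also have "\<bar>d v * f v\<bar> = (d v)\<^sup>2 * \<bar>g v\<bar>"
    using fg[OF v] dpos[OF v] by (simp add: abs_mult power2_eq_square)
  also note sumN
  finally have "q * d v * \<bar>g v\<bar> \<le> ((d v)\<^sup>2 + (\<Sum>w\<in>?N. d w)) * \<bar>g v\<bar>" by (simp add: algebra_simps)
  then have "q * d v \<le> (d v)\<^sup>2 + (\<Sum>w\<in>?N. d w)" using gpos by (rule mult_right_le_imp_le)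
  then show ?thesis using v unfolding d_def by (intro bexI)
qed

text \<open>The total degree is at least that of a vertex and its neighbours, and Merris' bound makes the latter
large. With \<open>x\<close> the degree of the vertex it gives a total of at least \<open>x * (2 * n - 2 * c - 1 - x)\<close>
and, since no degree exceeds \<open>n - 1\<close>, also \<open>n - 2 * c - 1 \<le> x \<le> n - 1\<close>. This concave function of \<open>x\<close>
is at least \<open>n * (n - 2 * c - 1)\<close> between the points \<open>n - 2 * c - 1\<close> and \<open>n\<close>, where it takes that
value.\<close>

lemma degree_sum_lower_bound:
  fixes c :: nat
  assumes G: "simple_graph G" and n: "card (verts G) = n" "n > 0"
    and pos: "\<And>v. v \<in> verts G \<Longrightarrow> vdegree G v > 0"
    and q: "Q_index G \<ge> 2 * (real n - real c - 1)"
  shows "n * (n - 1) \<le> (\<Sum>v\<in>verts G. vdegree G v) + 2 * c * n"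
proof -
  have fin: "finite (verts G)" using G by (simp add: simple_graph_def)
  have ne: "verts G \<noteq> {}" using n by auto
  define d where "d v = real (vdegree G v)" for v
  obtain v where v: "v \<in> verts G"
    and bound: "Q_index G * d v \<le> (d v)\<^sup>2 + (\<Sum>w\<in>{w \<in> verts G. adjacent G v w}. d w)"
    using signless_laplacian_eigenvalue_bound[OF G Q_index_eigenvalue[OF G ne] pos, folded d_def] by auto
  let ?N = "{w \<in> verts G. adjacent G v w}"
  have le: "d w \<le> real n - 1" if "w \<in> verts G" for w
  proof -
    have "degree_in (verts G) (adjacent G) w + card {x \<in> {}. \<not> adjacent G w x} < card (verts G)"
      by (rule degree_plus_nonneighbours_less_card[OF fin irreflp_adjacent[OF G] that]) simp
    then show ?thesis unfolding d_def using vdegree_eq_degree_in[OF G that] n by simp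
  qed
  have cardN: "real (card ?N) = d v"
    using vdegree_eq_degree_in[OF G v] by (simp add: d_def degree_in_def)
  have dv: "d v > 0" using pos[OF v] by (simp add: d_def)
  have "(\<Sum>w\<in>?N. d w) \<le> real (card ?N) * (real n - 1)"
    by (rule sum_bounded_above) (use le in auto)
  then have "(2 * (real n - real c - 1)) * d v \<le> (d v + (real n - 1)) * d v"
    using bound q dv mult_right_mono[OF q, of "d v"] cardN
    by (simp add: power2_eq_square algebra_simps)
  then have low: "real n - 2 * real c - 1 \<le> d v" using dv by (simp add: mult_le_cancel_right)
  have "(\<Sum>w\<in>insert v ?N. d w) \<le> (\<Sum>w\<in>verts G. d w)"
    using fin v by (intro sum_mono2) (auto simp: d_def)
  moreover have "(\<Sum>w\<in>insert v ?N. d w) = d v + (\<Sum>w\<in>?N. d w)"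
    using fin irreflp_adjacent[OF G] by (subst sum.insert) (auto dest: irreflpD)
  ultimately have "d v + (2 * (real n - real c - 1)) * d v - (d v)\<^sup>2 \<le> (\<Sum>w\<in>verts G. d w)"
    using bound mult_right_mono[OF q, of "d v"] dv by linarith
  \<comment> \<open>The concavity estimate: this product is the difference of the two sides.\<close>
  moreover have "0 \<le> (d v - (real n - 2 * real c - 1)) * (real n - d v)"
    using low le[OF v] by (intro mult_nonneg_nonneg) auto
  ultimately have "real n * (real n - 1) \<le> (\<Sum>w\<in>verts G. d w) + 2 * real c * real n"
    by (simp add: power2_eq_square algebra_simps)
  also have "real n * (real n - 1) = real (n * (n - 1))" using n(2) by (simp add: of_nat_diff)
  finally have "real (n * (n - 1)) \<le> real ((\<Sum>v\<in>verts G. vdegree G v) + 2 * c * n)"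
    unfolding d_def by simp
  then show ?thesis by (simp only: of_nat_le_iff)
qed

section \<open>Path covers and connectedness\<close>

lemma breaks_eq_0_successively: "breaks R ws = 0 \<Longrightarrow> successively R ws"
  by (induction R ws rule: breaks.induct) (auto split: if_splits)

text \<open>The induction cuts the ordering at one break; both parts have fewer breaks.\<close>

lemma ordering_path_cover:
  assumes "distinct ws" "set ws \<subseteq> verts G"
  shows "\<exists>P. finite P \<and> card P \<le> Suc (breaks (adjacent G) ws) \<and> (\<forall>p\<in>P. is_path G p) \<and>
     pairwise (\<lambda>p q. set p \<inter> set q = {}) P \<and> (\<Union>p\<in>P. set p) = set ws"
  using assms
proof (induction "breaks (adjacent G) ws" arbitrary: ws rule: less_induct)
  case less
  show ?case
  proof (cases "breaks (adjacent G) ws = 0")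
    case True
    show ?thesis
    proof (cases "ws = []")
      case True
      then show ?thesis by (intro exI[of _ "{}"]) auto
    next
      case False
      have "is_path G ws"
        unfolding is_path_def using False less.prems breaks_eq_0_successively[OF True] by simp
      then show ?thesis by (intro exI[of _ "{ws}"]) auto
    qed
  next
    case False
    then have "breaks (adjacent G) ws > 0" by simp
    then obtain xs x y ys where ws: "ws = xs @ x # y # ys" and nR: "\<not> adjacent G x y"
      by (rule breaks_split)
    let ?A = "xs @ [x]" and ?B = "y # ys"
    have eq: "ws = ?A @ ?B" using ws by simp
    have sum: "breaks (adjacent G) ws = breaks (adjacent G) ?A + breaks (adjacent G) ?B + 1"
      unfolding eq by (subst breaks_append) (use nR in simp)
    have prems: "distinct ?A" "set ?A \<subseteq> verts G" "distinct ?B" "set ?B \<subseteq> verts G"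
      and disj: "set ?A \<inter> set ?B = {}"
      using less.prems unfolding eq by auto
    have "breaks (adjacent G) ?A < breaks (adjacent G) ws" using sum by linarith
    from less.hyps[OF this prems(1,2)] obtain P where P: "finite P"
      "card P \<le> Suc (breaks (adjacent G) ?A)" "\<forall>p\<in>P. is_path G p"
      "pairwise (\<lambda>p q. set p \<inter> set q = {}) P" "(\<Union>p\<in>P. set p) = set ?A"
      by (elim exE conjE)
    have "breaks (adjacent G) ?B < breaks (adjacent G) ws" using sum by linarith
    from less.hyps[OF this prems(3,4)] obtain Q where Q: "finite Q"
      "card Q \<le> Suc (breaks (adjacent G) ?B)" "\<forall>p\<in>Q. is_path G p"
      "pairwise (\<lambda>p q. set p \<inter> set q = {}) Q" "(\<Union>p\<in>Q. set p) = set ?B"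
      by (elim exE conjE)
    have cross: "set p \<inter> set q = {}" if "p \<in> P" "q \<in> Q" for p q
    proof -
      have "set p \<subseteq> set ?A" "set q \<subseteq> set ?B" using that P(5) Q(5) by blast+
      then show ?thesis using disj by blast
    qed
    show ?thesis
    proof (intro exI[of _ "P \<union> Q"] conjI)
      show "finite (P \<union> Q)" using P(1) Q(1) by simp
      have "card (P \<union> Q) \<le> card P + card Q" by (rule card_Un_le)
      then show "card (P \<union> Q) \<le> Suc (breaks (adjacent G) ws)" using sum P(2) Q(2) by linarith
      show "\<forall>p\<in>P \<union> Q. is_path G p" using P(3) Q(3) by blast
      show "pairwise (\<lambda>p q. set p \<inter> set q = {}) (P \<union> Q)"
      proof (rule pairwiseI)
        fix p q assume "p \<in> P \<union> Q" "q \<in> P \<union> Q" "p \<noteq> q"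
        then show "set p \<inter> set q = {}"
          using pairwiseD[OF P(4)] pairwiseD[OF Q(4)] cross[of p q] cross[of q p] by blast
      qed
      show "(\<Union>p\<in>P \<union> Q. set p) = set ws" using P(5) Q(5) unfolding eq UN_Un set_append by simp
    qed
  qed
qed

lemma orderable_imp_path_coverable:
  assumes "orderable (verts G) (adjacent G) b"
  shows "path_coverable (Suc b) G"
proof -
  obtain ws where ws: "distinct ws" "set ws = verts G" "breaks (adjacent G) ws \<le> b"
    using assms unfolding orderable_def by blast
  from ordering_path_cover[OF ws(1), of G] ws(2) obtain P where P: "finite P"
      "card P \<le> Suc (breaks (adjacent G) ws)" "\<forall>p\<in>P. is_path G p"
      "pairwise (\<lambda>p q. set p \<inter> set q = {}) P" "(\<Union>p\<in>P. set p) = set ws"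
    by auto
  then show ?thesis unfolding path_coverable_def using ws
    by (intro exI[of _ P] conjI) auto
qed

lemma successively_crossing:
  assumes "successively R p" "p \<noteq> []" "hd p \<in> S" "last p \<notin> S"
  shows "\<exists>x\<in>S. \<exists>y\<in>set p - S. R x y"
  using assms
proof (induction p rule: induct_list012)
  case (3 x y zs)
  show ?case
  proof (cases "y \<in> S")
    case True
    then have "\<exists>x\<in>S. \<exists>z\<in>set (y # zs) - S. R x z" using 3 by (intro "3.IH"(2)) auto
    then show ?thesis by auto
  next
    case False
    then show ?thesis using "3.prems" by auto
  qed
qed auto

lemma connected_graph_cut:
  assumes "connected_graph G" "S \<subseteq> verts G" "S \<noteq> {}" "S \<noteq> verts G"
  shows "\<exists>x\<in>S. \<exists>y\<in>verts G - S. adjacent G x y"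
proof -
  obtain u v where "u \<in> S" "v \<in> verts G - S" using assms(2-4) by blast
  then obtain p where p: "is_path G p" "hd p = u" "last p = v"
    using assms(1,2) unfolding connected_graph_def by blast
  have "\<exists>x\<in>S. \<exists>y\<in>set p - S. adjacent G x y"
    using p \<open>u \<in> S\<close> \<open>v \<in> verts G - S\<close>
    by (intro successively_crossing) (auto simp: is_path_def)
  then show ?thesis using p(1) unfolding is_path_def by blast
qed

section \<open>The extremal family\<close>

lemma B_graph_verts:
  "verts (B_graph n k d) = {..<d} <+> ({..<n - 2 * d - k} <+> {..<d + k})"
  by (simp add: B_graph_def join_graph_def disjoint_union_def complete_graph_def empty_graph_def)

lemma B_graph_edges:
  "a < d \<Longrightarrow> b < d \<Longrightarrow> a \<noteq> b \<Longrightarrow> {Inl a, Inl b} \<in> edges (B_graph n k d)"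
  "a < d \<Longrightarrow> x \<in> {..<n - 2 * d - k} <+> {..<d + k} \<Longrightarrow> {Inl a, Inr x} \<in> edges (B_graph n k d)"
  "i < n - 2 * d - k \<Longrightarrow> j < n - 2 * d - k \<Longrightarrow> i \<noteq> j \<Longrightarrow>
     {Inr (Inl i), Inr (Inl j)} \<in> edges (B_graph n k d)"
proof -
  assume "a < d" "b < d" "a \<noteq> b"
  then have "{a, b} \<in> edges (complete_graph d)" by (simp add: complete_graph_def)
  then have "Inl ` {a, b} \<in> edges (B_graph n k d)"
    unfolding B_graph_def join_graph_def disjoint_union_def graph.simps by blast
  then show "{Inl a, Inl b} \<in> edges (B_graph n k d)" by simp
next
  assume "a < d" "x \<in> {..<n - 2 * d - k} <+> {..<d + k}"
  then show "{Inl a, Inr x} \<in> edges (B_graph n k d)"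
    by (auto simp: B_graph_def join_graph_def disjoint_union_def complete_graph_def empty_graph_def)
next
  assume "i < n - 2 * d - k" "j < n - 2 * d - k" "i \<noteq> j"
  then have "{i, j} \<in> edges (complete_graph (n - 2 * d - k))" by (simp add: complete_graph_def)
  then have "Inr ` Inl ` {i, j} \<in> edges (B_graph n k d)"
    unfolding B_graph_def join_graph_def disjoint_union_def graph.simps by blast
  then show "{Inr (Inl i), Inr (Inl j)} \<in> edges (B_graph n k d)" by simp
qed

text \<open>A graph with such sets embeds in \<open>B(n, k, d)\<close> by sending \<open>Y\<close> to the dominating clique, \<open>S\<close> to the
independent part and all other vertices to the second clique. Membership in the family then holds
with no edge deleted.\<close>

lemma B1_familyI:
  fixes G :: "'a graph"
  assumes G: "simple_graph G" and n: "card (verts G) = n"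
    and S: "S \<subseteq> verts G" "card S = d + k" and Y: "Y \<subseteq> verts G - S" "card Y = d"
    and nonadj: "\<And>x y. x \<in> S \<Longrightarrow> y \<in> verts G - Y \<Longrightarrow> \<not> adjacent G x y"
  shows "G \<in> B1_family n k d"
proof -
  let ?V = "verts G" and ?B = "B_graph n k d"
  define Z where "Z = ?V - S - Y"
  have fin: "finite ?V" using G by (simp add: simple_graph_def)
  have f: "finite S" "finite Y" "finite Z"
    using fin finite_subset[OF S(1)] finite_subset[OF Y(1)] by (auto simp: Z_def)
  have cZ: "card Z = n - 2 * d - k"
  proof -
    have "card Z = card (?V - S) - card Y" unfolding Z_def by (rule card_Diff_subset[OF f(2) Y(1)])
    also have "card (?V - S) = n - card S" using card_Diff_subset[OF f(1) S(1)] n by simp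
    finally show ?thesis using S Y by simp
  qed
  obtain gS gY gZ where g: "bij_betw gS S {..<d + k}" "bij_betw gY Y {..<d}"
      "bij_betw gZ Z {..<n - 2 * d - k}"
    using ex_bij_betw_finite_nat[OF f(1)] ex_bij_betw_finite_nat[OF f(2)]
      ex_bij_betw_finite_nat[OF f(3)] S(2) Y(2) cZ by (auto simp: lessThan_atLeast0)
  define h where "h v = (if v \<in> Y then Inl (gY v)
      else if v \<in> S then Inr (Inr (gS v)) else Inr (Inl (gZ v)))" for v
  have hY: "h v = Inl (gY v)" "gY v < d" if "v \<in> Y" for v
    using that g(2) by (auto simp: h_def bij_betw_def)
  have hS: "h v = Inr (Inr (gS v))" "gS v < d + k" if "v \<in> S" for v
    using that g(1) Y by (auto simp: h_def bij_betw_def)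
  have hZ: "h v = Inr (Inl (gZ v))" "gZ v < n - 2 * d - k" if "v \<in> Z" for v
    using that g(3) by (auto simp: h_def Z_def bij_betw_def)
  have V: "?V = Y \<union> S \<union> Z" using S Y by (auto simp: Z_def)
  have inj: "inj_on h ?V"
  proof (rule inj_onI)
    fix u v assume uv: "u \<in> ?V" "v \<in> ?V" "h u = h v"
    have inj: "inj_on gS S" "inj_on gY Y" "inj_on gZ Z" using g by (auto simp: bij_betw_def)
    from uv show "u = v"
      unfolding V using inj by (auto simp: hY hS hZ dest: inj_onD)
  qed
  have hB: "h ` ?V \<subseteq> verts ?B"
    unfolding V B_graph_verts by (auto simp: hY hS hZ simp del: diff_diff_left)
  have tail: "\<exists>x. h v = Inr x \<and> x \<in> {..<n - 2 * d - k} <+> {..<d + k}" if "v \<in> S \<union> Z" for v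
    using that hS[of v] hZ[of v] by auto
  have edge: "{h u, h v} \<in> edges ?B" if uv: "{u, v} \<in> edges G" for u v
  proof -
    have "card {u, v} = 2" "{u, v} \<subseteq> ?V" using uv G by (auto simp: simple_graph_def)
    then have ne: "u \<noteq> v" and mem: "u \<in> ?V" "v \<in> ?V" by auto
    then have hne: "h u \<noteq> h v" using inj by (auto dest: inj_onD)
    have vu: "{v, u} \<in> edges G" using uv by (simp add: insert_commute)
    consider "u \<in> Y" "v \<in> Y" | "u \<in> Y" "v \<in> S \<union> Z" | "v \<in> Y" "u \<in> S \<union> Z" | "u \<in> Z" "v \<in> Z"
    proof -
      have "u \<in> S \<Longrightarrow> v \<in> Y" "v \<in> S \<Longrightarrow> u \<in> Y"
        using nonadj[of u v] nonadj[of v u] uv vu mem by blast+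
      then show ?thesis using that mem unfolding V by blast
    qed
    then show ?thesis
    proof cases
      case 1
      then show ?thesis using hne by (simp add: hY B_graph_edges(1))
    next
      case 2
      obtain x where "h v = Inr x" "x \<in> {..<n - 2 * d - k} <+> {..<d + k}" using tail[OF 2(2)] by blast
      then show ?thesis using hY[OF 2(1)] B_graph_edges(2) by simp
    next
      case 3
      obtain x where "h u = Inr x" "x \<in> {..<n - 2 * d - k} <+> {..<d + k}" using tail[OF 3(2)] by blast
      then have "{h v, h u} \<in> edges ?B" using hY[OF 3(1)] B_graph_edges(2) by simp
      then show ?thesis by (simp add: insert_commute)
    next
      case 4
      then show ?thesis
        using hne hZ[OF 4(1)] hZ[OF 4(2)] B_graph_edges(3)[where i = "gZ u" and j = "gZ v"] by simp
    qed
  qed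
  define H where "H = \<lparr>verts = h ` ?V, edges = (`) h ` edges G\<rparr>"
  have "subgraph H ?B"
    unfolding subgraph_def
  proof (intro conjI)
    show "simple_graph H"
      unfolding simple_graph_def
    proof (intro conjI subsetI)
      show "finite (verts H)" using fin by (simp add: H_def)
      fix e' assume "e' \<in> edges H"
      then obtain e where e: "e \<in> edges G" "e' = h ` e" by (auto simp: H_def)
      then have "e \<subseteq> ?V" "card e = 2" using G by (auto simp: simple_graph_def)
      then show "e' \<in> {e. e \<subseteq> verts H \<and> card e = 2}"
        using card_image[OF inj_on_subset[OF inj]] e by (auto simp: H_def)
    qed
    show "verts H \<subseteq> verts ?B" using hB by (simp add: H_def)
    show "edges H \<subseteq> edges ?B"
    proof
      fix e' assume "e' \<in> edges H"
      then obtain e where e: "e \<in> edges G" "e' = h ` e" by (auto simp: H_def)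
      then have "card e = 2" using G by (auto simp: simple_graph_def)
      then obtain u v where "e = {u, v}" by (auto simp: card_2_iff)
      then show "e' \<in> edges ?B" using edge e by simp
    qed
  qed
  moreover have "delete_edges ?B {} = ?B" by (simp add: delete_edges_def)
  moreover have "graph_iso G H"
    unfolding graph_iso_def H_def using inj by (intro exI[of _ h]) (simp add: bij_betw_def)
  ultimately show ?thesis
    unfolding B1_family_def by (intro CollectI exI[of _ "{}"] exI[of _ H]) simp
qed

theorem theorem1p4:
  fixes G :: "'a graph" and n k \<delta> :: nat
  assumes "k \<ge> 1" and "\<delta> \<ge> 2"
    and "simple_graph G" and "connected_graph G"
    and "card (verts G) = n"
    and "n \<ge> (\<delta>^2 + k * \<delta> + 7 * \<delta> + 6 * k + 9) * (\<delta>^2 + k * \<delta> + 1)"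
    and "min_degree G \<ge> \<delta>"
    and "Q_index G \<ge> 2 * (real n - real \<delta> - real k - 1)"
    and "G \<notin> B1_family n k \<delta>"
  shows "path_coverable k G"
proof (rule ccontr)
  assume not_cov: "\<not> path_coverable k G"
  note k = assms(1) and d = assms(2) and G = assms(3) and conn = assms(4) and n = assms(5)
    and size = assms(6)
  have fin: "finite (verts G)" using G by (simp add: simple_graph_def)
  have no: "\<not> orderable (verts G) (adjacent G) (k - 1)"
    using not_cov orderable_imp_path_coverable[of G "k - 1"] k by auto
  have mindeg: "\<delta> \<le> vdegree G v" if "v \<in> verts G" for v
  proof -
    have "min_degree G \<le> vdegree G v"
      unfolding min_degree_def using fin that by (intro Min_le) auto
    then show ?thesis using assms(7) by linarith
  qed
  have large: "(\<delta> + k + 1) * (12 * \<delta> + 12 * k + 1) < 2 * n"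
  proof -
    \<comment> \<open>Both factors of the assumed bound on \<open>n\<close> dominate linear functions of \<open>\<delta>\<close> and \<open>k\<close>.\<close>
    have sq: "2 * \<delta> \<le> \<delta>\<^sup>2" "2 * k \<le> k * \<delta>"
      using d by (auto simp: power2_eq_square)
    have "(\<delta> + k + 1) * (12 * \<delta> + 12 * k + 1) < (\<delta> + k + 1) * (18 * \<delta> + 16 * k + 18)"
      by (rule mult_strict_left_mono) auto
    also have "\<dots> \<le> (\<delta>\<^sup>2 + k * \<delta> + 1) * (2 * (\<delta>\<^sup>2 + k * \<delta> + 7 * \<delta> + 6 * k + 9))"
    proof (rule mult_mono)
      show "\<delta> + k + 1 \<le> \<delta>\<^sup>2 + k * \<delta> + 1" using sq by linarith
      have "2 * (\<delta>\<^sup>2 + k * \<delta> + 7 * \<delta> + 6 * k + 9) = 2 * \<delta>\<^sup>2 + 2 * (k * \<delta>) + (14 * \<delta> + 12 * k + 18)"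
        by simp
      then show "18 * \<delta> + 16 * k + 18 \<le> 2 * (\<delta>\<^sup>2 + k * \<delta> + 7 * \<delta> + 6 * k + 9)"
        using sq by linarith
    qed simp_all
    also have "\<dots> = 2 * ((\<delta>\<^sup>2 + k * \<delta> + 7 * \<delta> + 6 * k + 9) * (\<delta>\<^sup>2 + k * \<delta> + 1))"
      by (simp only: mult_ac)
    also have "\<dots> \<le> 2 * n" by (rule mult_left_mono[OF size]) simp
    finally show ?thesis .
  qed
  then have npos: "n > 0" by (cases n) auto
  have pos: "vdegree G v > 0" if "v \<in> verts G" for v using mindeg[OF that] d by linarith
  have "2 * (real n - real (\<delta> + k) - 1) \<le> Q_index G" using assms(8) by simp
  from degree_sum_lower_bound[OF G n npos pos this]
  have sum: "n * (n - 1) \<le> (\<Sum>v\<in>verts G. degree_in (verts G) (adjacent G) v) + 2 * (\<delta> + k) * n"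
    using vdegree_eq_degree_in[OF G] by simp
  have mindeg': "\<delta> \<le> degree_in (verts G) (adjacent G) v" if "v \<in> verts G" for v
    using mindeg[OF that] vdegree_eq_degree_in[OF G that] by simp
  show False
  proof (rule dense_nonorderable_structure[OF fin n symp_adjacent irreflp_adjacent[OF G] k large
        mindeg' sum connected_graph_cut[OF conn] no])
    fix S Y
    assume "S \<subseteq> verts G" "Y \<subseteq> verts G - S" "card S = \<delta> + k" "card Y = \<delta>"
      "\<And>x y. x \<in> S \<Longrightarrow> y \<in> verts G - Y \<Longrightarrow> \<not> adjacent G x y"
    then have "G \<in> B1_family n k \<delta>" by (intro B1_familyI[OF G n])
    then show False using assms(9) by simp
  qed
qed

end
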